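(* Let $q\ge1$, and let $k,A$ be positive integers; put $K=\max(k,\omega(q))$. For all $x\ge\left(4(Ak+K)\log(Ak+K)\right)^A$ we have, uniformly, $$\mathbb E\left(\left|{\sum_{n\le x}}^{\flat}X_n\right|^{2k}\right)^{\frac1{2k}}\ge\left({\sum_{N\le x^k}}^{\flat}d_k(N,x)^2\right)^{\frac1{2k}}\gg x^{\frac12}\left(\frac{k}{\log x}\right)^{\frac A2}.$$
   Context: $(X_n)_{n\ge1}$ is a random completely multiplicative function: for primes $p$, the $X_p$ are independent random variables uniformly distributed on the unit circle, and $X_n=\prod_i X_{p_i}^{a_i}$ if $n=\prod_i p_i^{a_i}$. $\mathbb E$ denotes expectation. ${\sum}^{\flat}$ indicates that the sum is restricted to squarefree integers coprime to $q$. $\omega(q)$ is the number of distinct prime factors of $q$. $d_k(N,x)$ is the number of $k$-tuples $(m_1,\dots,m_k)$ of positive integers with $m_1\cdots m_k=N$ and all $m_i\le x$. The implied constant is absolute. *)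

theory Defs
  imports "HOL-Probability.Probability" "HOL-Computational_Algebra.Computational_Algebra"
begin

definition uniform_circle :: "complex measure" where
  "uniform_circle = distr (uniform_measure lborel {0..2 * pi}) borel cis"

text \<open>The value at 0 is left unconstrained, as only positive indices have a meaning.\<close>

locale random_comp_mult = prob_space M for M :: "'a measure" +
  fixes X :: "nat \<Rightarrow> 'a \<Rightarrow> complex"
  assumes indep: "indep_vars (\<lambda>_. borel) X {p. prime p}"
    and uniform: "\<And>p. prime p \<Longrightarrow> distr M borel (X p) = uniform_circle"
    and mult: "\<And>n w. n > 0 \<Longrightarrow> w \<in> space M \<Longrightarrow>
                 X n w = (\<Prod>p\<in>prime_factors n. X p w ^ multiplicity p n)"

definition flat_nats :: "nat \<Rightarrow> real \<Rightarrow> nat set" where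
  "flat_nats q y = {n. 0 < n \<and> real n \<le> y \<and> squarefree n \<and> coprime n q}"

definition omega :: "nat \<Rightarrow> nat" where
  "omega q = card (prime_factors q)"

text \<open>The \<open>k\<close>-tuples are represented as lists of length \<open>k\<close>.\<close>

definition d_trunc :: "nat \<Rightarrow> nat \<Rightarrow> real \<Rightarrow> nat" where
  "d_trunc k N x =
     card {ms :: nat list. length ms = k \<and> prod_list ms = N \<and> (\<forall>m\<in>set ms. 0 < m \<and> real m \<le> x)}"

end

theory Submission
  imports Defs "HOL-Real_Asymp.Real_Asymp"
begin

text \<open>The \<open>k\<close>-th power of the sum over \<open>n \<le> x\<close> is a sum of \<open>X\<^sub>N\<close> over \<open>k\<close>-tuples with product \<open>N\<close>,
  and the \<open>X\<^sub>N\<close> are orthonormal; restricting to squarefree \<open>N\<close> coprime to \<open>q\<close> gives the first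
  inequality. For the second one, put \<open>y = x\<^bsup>1/A\<^esup>\<close> and keep only the \<open>N\<close> that are products of
  \<open>A k\<close> distinct primes \<open>p \<le> y\<close> not dividing \<open>q\<close>. Distributing these primes into \<open>k\<close> blocks of
  size \<open>A\<close> yields \<open>d\<^sub>k(N, x) \<ge> (A k)! / A!\<^sup>k\<close>, and Chebyshev's bound
  \<open>\<pi>(y) \<ge> (y - 2) ln 2 / ln y\<close> provides sufficiently many such \<open>N\<close>: with \<open>m = A k + K\<close> the
  hypothesis \<open>y \<ge> 4 m ln m\<close> makes \<open>m\<close> asymptotically at most a quarter of \<open>y / ln y\<close>, and
  \<open>ln 2 - 1/4 > 1/e\<close>, so that the implied constant does not deteriorate as \<open>A\<close> grows.\<close>

section \<open>Chebyshev's lower bound for the number of primes\<close>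

definition primes_upto :: "real \<Rightarrow> nat set" where
  "primes_upto y = {p. prime p \<and> real p \<le> y}"

lemma finite_primes_upto [simp]: "finite (primes_upto y)"
proof (rule finite_subset)
  show "primes_upto y \<subseteq> {..nat \<lfloor>y\<rfloor>}"
    by (auto simp: primes_upto_def le_nat_floor)
qed simp

section \<open>The least common multiple of 1, ..., n\<close>

text \<open>The witness is lcm(1, ..., n), written as the product over the primes p <= n of the
  largest power of p not exceeding n; each of these factors is at most n.\<close>

lemma common_multiple_le_power:
  fixes n :: nat
  assumes "n \<ge> 1"
  shows "\<exists>D>0. (\<forall>j\<in>{1..n}. j dvd D) \<and> D \<le> n ^ card (primes_upto n)"
proof -
  define P where "P = primes_upto n"
  define e where "e p = Max {a. p ^ a \<le> n}" for p
  have fin: "finite {a. p ^ a \<le> n}" if "p \<in> P" for p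
  proof (rule finite_subset)
    have "p \<ge> 2" using that by (simp add: P_def primes_upto_def prime_ge_2_nat)
    then have "a < p ^ a" for a by (intro power_gt_expt) auto
    then show "{a. p ^ a \<le> n} \<subseteq> {..n}"
      by (auto intro: less_imp_le order.strict_trans2)
  qed simp
  have e_le: "p ^ e p \<le> n" if "p \<in> P" for p
  proof -
    have "0 \<in> {a. p ^ a \<le> n}" using assms by simp
    then show ?thesis using Max_in[OF fin[OF that]] unfolding e_def by blast
  qed
  have e_ge: "a \<le> e p" if "p \<in> P" "p ^ a \<le> n" for a p
    unfolding e_def using fin that by (intro Max_ge) auto
  define D where "D = (\<Prod>p\<in>P. p ^ e p)"
  have "j dvd D" if j: "j \<in> {1..n}" for j
  proof -
    have sub: "prime_factors j \<subseteq> P"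
    proof
      fix p assume "p \<in> prime_factors j"
      then have "prime p" "p dvd j" by auto
      moreover from this j have "p \<le> n" using dvd_imp_le[of p j] by simp
      ultimately show "p \<in> P" by (simp add: P_def primes_upto_def)
    qed
    have "j = (\<Prod>p\<in>prime_factors j. p ^ multiplicity p j)"
      using j prod_prime_factors[of j] by simp
    also have "\<dots> = (\<Prod>p\<in>P. p ^ multiplicity p j)"
      using sub by (intro prod.mono_neutral_left)
        (auto simp: P_def primes_upto_def prime_factors_multiplicity)
    also have "\<dots> dvd D" unfolding D_def
    proof (intro prod_dvd_prod le_imp_power_dvd e_ge)
      fix p assume "p \<in> P"
      show "p ^ multiplicity p j \<le> n"
        using dvd_imp_le[OF multiplicity_dvd[of p j]] j by simp
    qed
    finally show ?thesis .
  qed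
  moreover have "D > 0" unfolding D_def
    by (intro prod_pos) (auto simp: P_def primes_upto_def prime_gt_0_nat)
  moreover have "D \<le> n ^ card P"
    unfolding D_def using prod_mono[of P "\<lambda>p. p ^ e p" "\<lambda>_. n"] e_le by simp
  ultimately show ?thesis unfolding P_def by blast
qed

text \<open>In Leibniz' harmonic triangle with entries \<open>1 / ((r + 1) (r choose k))\<close>, each entry is the
  difference of two entries of the preceding column.\<close>

lemma harmonic_triangle_Ints:
  fixes D :: nat
  assumes "\<And>j. 1 \<le> j \<Longrightarrow> j \<le> n \<Longrightarrow> j dvd D"
  shows "k \<le> r \<Longrightarrow> r < n \<Longrightarrow> real D / (real (Suc r) * real (r choose k)) \<in> \<int>"
proof (induction k arbitrary: r)
  case 0
  then obtain c where "D = Suc r * c" using assms[of "Suc r"] by (auto elim: dvdE)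
  then have "real D = real (Suc r) * real c" by (simp only: of_nat_mult)
  moreover have "real (Suc r) \<noteq> 0" by simp
  ultimately have "real D / (real (Suc r) * real (r choose 0)) = real c"
    by (simp only: binomial_n_0 of_nat_1 mult_1_right) (rule nonzero_mult_div_cancel_left)
  then show ?case by (simp only: Ints_of_nat)
next
  case (Suc k)
  then obtain s where r: "r = Suc s" "k \<le> s" by (cases r) auto
  define b where "b = real (s choose k)"
  have b: "b > 0" using r by (simp add: b_def)
  have "Suc k * (Suc s choose Suc k) = Suc s * (s choose k)"
    by (rule Suc_times_binomial)
  then have "real (Suc k * (Suc s choose Suc k)) = real (Suc s * (s choose k))" by presburger
  then have 1: "real (Suc s choose Suc k) = real (Suc s) * b / real (Suc k)"
    unfolding b_def of_nat_mult by (simp add: field_simps del: of_nat_Suc binomial_Suc_Suc)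
  have "(Suc s - k) * (Suc s choose k) = Suc s * (s choose k)"
    using binomial_absorb_comp[of "Suc s" k] by simp
  then have "real ((Suc s - k) * (Suc s choose k)) = real (Suc s * (s choose k))" by presburger
  then have 2: "real (Suc s choose k) = real (Suc s) * b / real (Suc s - k)"
    unfolding b_def of_nat_mult using r by (simp add: field_simps del: of_nat_Suc)
  have "real D / (real (Suc r) * real (r choose Suc k)) =
      real D / (real (Suc s) * real (s choose k)) - real D / (real (Suc r) * real (r choose k))"
    unfolding r 1 2 b_def[symmetric] using b r(2)
    by (simp add: divide_simps of_nat_diff) (simp add: algebra_simps)
  also have "\<dots> \<in> \<int>" by (intro Ints_diff Suc.IH) (use Suc.prems r in auto)
  finally show ?case .
qed

text \<open>D times an entry of row r = n - 1 of the triangle is a positive integer, hence at least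
  1, so (r + 1) (r choose k) <= D. Summing over the r + 1 values of k turns the binomials into
  2^r.\<close>

lemma common_multiple_ge_power_2:
  fixes D :: nat
  assumes "\<And>j. 1 \<le> j \<Longrightarrow> j \<le> n \<Longrightarrow> j dvd D" "D > 0" "n \<ge> 1"
  shows "2 ^ (n - 1) \<le> D"
proof -
  define r where "r = n - 1"
  have *: "Suc r * (r choose k) \<le> D" if "k \<le> r" for k
  proof -
    have "real D / (real (Suc r) * real (r choose k)) \<in> \<int>"
      using assms that by (intro harmonic_triangle_Ints[of n]) (auto simp: r_def)
    moreover have "real D / (real (Suc r) * real (r choose k)) > 0"
      using assms that by simp
    ultimately have "real D / (real (Suc r) * real (r choose k)) \<ge> 1"
      by (auto elim!: Ints_cases)
    then have "real (Suc r) * real (r choose k) \<le> real D"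
      using that by (simp add: divide_simps split: if_splits)
    then show ?thesis by (metis of_nat_le_iff of_nat_mult)
  qed
  have "Suc r * 2 ^ r = (\<Sum>k\<le>r. Suc r * (r choose k))"
    by (simp only: sum_distrib_left[symmetric] choose_row_sum)
  also have "\<dots> \<le> (\<Sum>k\<le>r. D)" by (intro sum_mono *) auto
  also have "\<dots> = Suc r * D" by simp
  finally show ?thesis unfolding r_def by (simp only: Suc_mult_le_cancel1)
qed

text \<open>The two bounds for a common multiple of 1, ..., n give 2^(n-1) <= n^pi(n) for n = floor
  y. The 2 in \<open>y - 2\<close> comes from n - 1 > y - 2.\<close>

lemma chebyshev_lower:
  assumes "y \<ge> 1"
  shows "(y - 2) * ln 2 \<le> real (card (primes_upto y)) * ln y"
proof -
  define n where "n = nat \<lfloor>y\<rfloor>"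
  have n: "n \<ge> 1" "real n \<le> y" "y < real n + 1"
    using assms by (auto simp: n_def) linarith+
  have "real p \<le> y \<longleftrightarrow> real p \<le> real n" for p
  proof
    assume "real p \<le> y"
    then show "real p \<le> real n" unfolding n_def by (simp only: of_nat_le_iff le_nat_floor)
  qed (use n(2) in linarith)
  then have P: "primes_upto y = primes_upto n" by (simp add: primes_upto_def)
  obtain D where D: "D > 0" "\<forall>j\<in>{1..n}. j dvd D" "D \<le> n ^ card (primes_upto n)"
    using common_multiple_le_power[OF n(1)] by blast
  have "2 ^ (n - 1) \<le> D" using D n by (intro common_multiple_ge_power_2) auto
  then have "2 ^ (n - 1) \<le> n ^ card (primes_upto n)" using D(3) by linarith
  then have "(2::real) ^ (n - 1) \<le> real n ^ card (primes_upto n)"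
    by (metis of_nat_le_iff of_nat_numeral of_nat_power)
  then have "ln ((2::real) ^ (n - 1)) \<le> ln (real n ^ card (primes_upto n))"
    using n by (subst ln_le_cancel_iff) auto
  then have "real (n - 1) * ln 2 \<le> real (card (primes_upto n)) * ln (real n)"
    using n by (simp add: ln_realpow)
  also have "\<dots> \<le> real (card (primes_upto n)) * ln y"
    using n by (intro mult_left_mono) auto
  finally have "real (n - 1) * ln 2 \<le> real (card (primes_upto n)) * ln y" .
  moreover have "(y - 2) * ln 2 \<le> real (n - 1) * ln 2"
    using n by (intro mult_right_mono) auto
  ultimately show ?thesis unfolding P by linarith
qed

section \<open>Primes in excess of m when y >= 4 m ln m\<close>

lemma ln_bounds: "ln (2::real) \<ge> 2 / 3" "ln (2::real) \<le> 3 / 4" "ln (3::real) \<ge> 1"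
proof -
  show "ln (2::real) \<ge> 2 / 3" by (rule ln2_ge_two_thirds)
  have "exp (3 / 4 :: real) \<ge> 2"
    using exp_lower_Taylor_quadratic[of "3 / 4"] by (simp add: power2_eq_square)
  then show "ln (2::real) \<le> 3 / 4" by (metis ln_exp ln_le_cancel_iff exp_gt_zero zero_less_numeral)
  show "ln (3::real) \<ge> 1" using exp_le ln_ge_iff[of 3 1] by simp
qed

text \<open>The extreme case is m = 2 with 8 ln 2 >= 16/3. As 5 > e, this gives ln y > 1 whenever y
  >= 4 m ln m.\<close>

lemma four_m_ln_m_gt_5:
  assumes "m \<ge> 2"
  shows "4 * real m * ln (real m) > 5"
proof -
  have "ln (real m) \<ge> ln 2" using assms by (subst ln_le_cancel_iff) auto
  then have "real m * ln (real m) \<ge> 2 * (2 / 3)"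
    using assms ln_bounds(1) by (intro mult_mono) linarith+
  then show ?thesis by simp
qed

text \<open>For m = 2 and m = 3 the primes are listed; for m >= 4 Chebyshev's bound is shown to
  exceed m ln y. With m = A k + K this leaves A k primes after those dividing q are removed.\<close>

lemma card_primes_upto_ge:
  assumes m: "m \<ge> 2" and y: "y \<ge> 4 * real m * ln (real m)"
  shows "m \<le> card (primes_upto y)"
proof -
  have sub: "card S \<le> card (primes_upto y)" if "S \<subseteq> {p. prime p \<and> real p \<le> y}" for S
    using that by (intro card_mono) (simp_all flip: primes_upto_def)
  consider "m = 2" | "m = 3" | "m \<ge> 4" using m by linarith
  then show ?thesis
  proof cases
    case 1
    then have "{2, 3} \<subseteq> {p::nat. prime p \<and> real p \<le> y}" using y ln_bounds by auto
    from sub[OF this] 1 show ?thesis by simp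
  next
    case 2
    then have "{2, 3, 5} \<subseteq> {p::nat. prime p \<and> real p \<le> y}" using y ln_bounds by auto
    from sub[OF this] 2 show ?thesis by simp
  next
    case 3
    define L where "L = ln (real m)"
    define t where "t = 4 * real m * L"
    have "ln (real m) \<ge> ln (2 ^ 2)" using 3 by (subst ln_le_cancel_iff) auto
    then have L: "L \<ge> 2 * ln 2" unfolding L_def by (subst (asm) ln_realpow) auto
    have Lpos: "L \<ge> 4 / 3" using L ln_bounds by linarith
    have t: "t \<ge> 16" 
    proof -
      have "4 * 1 \<le> real m * L" using 3 Lpos by (intro mult_mono) auto
      then show ?thesis unfolding t_def by linarith
    qed
    have yt: "y \<ge> t" using y by (simp add: t_def L_def)
    have "ln t = 2 * ln 2 + L + ln L"
    proof -
      have "ln t = ln (2 ^ 2) + ln (real m) + ln L"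
        unfolding t_def using 3 Lpos by (simp add: ln_mult_pos)
      then show ?thesis by (subst (asm) ln_realpow) (auto simp: L_def)
    qed
    then have lnt: "ln t \<le> 2 * ln 2 + 2 * L - 1"
      using ln_le_minus_one[of L] Lpos by linarith
    \<comment> \<open>The tangent of ln at t reduces the comparison to y = t: beyond t, the bound
      for \<open>m * ln y\<close> has slope m / t = 1 / (4 L), which is at most the slope ln 2 of
      Chebyshev's bound.\<close>
    have lny: "ln y \<le> ln t + (y - t) / t"
    proof -
      have "ln (y / t) \<le> y / t - 1" using t yt by (intro ln_le_minus_one) auto
      then show ?thesis using t yt by (simp add: ln_div diff_divide_distrib)
    qed
    have "real m * ln y \<le> real m * ln t + real m * ((y - t) / t)"
      using lny mult_left_mono[of "ln y" "ln t + (y - t) / t" "real m"]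
      by (simp add: distrib_left)
    also have "real m * ((y - t) / t) = (y - t) / (4 * L)"
      unfolding t_def using 3 Lpos by (simp add: field_simps)
    also have "\<dots> \<le> (y - t) * ln 2"
    proof -
      have "(4 / 3) * (2 / 3) \<le> L * ln 2" using Lpos ln_bounds by (intro mult_mono) auto
      then have "1 / (4 * L) \<le> ln 2" using Lpos by (simp add: field_simps)
      then show ?thesis using mult_left_mono[of "1 / (4 * L)" "ln 2" "y - t"] yt by simp
    qed
    also have "real m * ln t < (t - 2) * ln 2"
    proof -
      have "real m * ln t \<le> real m * (2 * ln 2 + 2 * L - 1)"
        using lnt by (intro mult_left_mono) auto
      \<comment> \<open>The term \<open>ln 2 / 2\<close> pays for the 2 in \<open>t - 2\<close>,
        since m >= 4 gives m ln 2 / 2 >= 2 ln 2.\<close>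
      also have "\<dots> < real m * (4 * L * ln 2 - ln 2 / 2)"
      proof (intro mult_strict_left_mono)
        have "L * (4 * ln 2 - 2) \<ge> L * (2 / 3)" 
          using Lpos ln_bounds by (intro mult_left_mono) auto
        moreover have "L * (4 * ln 2 - 2) = 4 * L * ln 2 - 2 * L"
          by (simp add: algebra_simps)
        ultimately show "2 * ln 2 + 2 * L - 1 < 4 * L * ln 2 - ln 2 / 2"
          using Lpos ln_bounds by linarith
      qed (use 3 in auto)
      also have "\<dots> \<le> (t - 2) * ln 2"
        using 3 unfolding t_def by (simp add: algebra_simps)
      finally show ?thesis .
    qed
    finally have *: "real m * ln y < (y - 2) * ln 2" by (simp add: algebra_simps)
    also have "\<dots> \<le> real (card (primes_upto y)) * ln y"
      using t yt by (intro chebyshev_lower) auto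
    finally show ?thesis using t yt by (simp add: mult_less_cancel_right)
  qed
qed

text \<open>At t = 4 m ln m the ratio of m to t / ln t tends to 1/4, so eventually it is at most
  26/100. Chebyshev's bound with ln 2 >= 2/3 gives at least 66/100 y / ln y primes, and the
  difference of the two constants is 2/5.\<close>

lemma eventually_card_primes_upto_ge:
  "\<forall>\<^sub>F m in sequentially. \<forall>y \<ge> 4 * real m * ln (real m).
     real (card (primes_upto y)) - real m + 1 \<ge> 2 / 5 * (y / ln y)"
proof -
  have e1: "eventually (\<lambda>m::nat. real m \<le> 26 / 100 * (4 * real m * ln (real m) / ln (4 * real m * ln (real m)))) sequentially"
    by real_asymp
  have e2: "eventually (\<lambda>m::nat. 4 * real m * ln (real m) \<ge> 1000) sequentially"
    by real_asymp
  from e1 e2 show ?thesis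
  proof eventually_elim
    case (elim m)
    define t where "t = 4 * real m * ln (real m)"
    show ?case
    proof (intro allI impI)
      fix y assume "y \<ge> 4 * real m * ln (real m)"
      then have y: "y \<ge> t" "t \<ge> 1000" using elim by (auto simp: t_def)
      have lt: "ln t > 1" "ln y > 1" using y exp_le ln_less_cancel_iff[of "exp 1" t]
          ln_less_cancel_iff[of "exp 1" y] by auto
      \<comment> \<open>The function y / ln y increases beyond e, so the bound for m at t carries
        over to y.\<close>
      have "t / ln t \<le> y / ln y"
      proof -
        have "ln (y / t) \<le> y / t - 1" using y by (intro ln_le_minus_one) auto
        then have "ln y - ln t \<le> (y - t) / t" using y by (simp add: ln_div diff_divide_distrib)
        then have "t * (ln y - ln t) \<le> (y - t) * 1" using y by (simp add: field_simps)
        also have "\<dots> \<le> (y - t) * ln t" using lt y by (intro mult_left_mono) auto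
        finally show ?thesis using lt by (simp add: field_simps)
      qed
      then have m: "real m \<le> 26 / 100 * (y / ln y)" using elim(1)[folded t_def] by linarith
      have "(y - 2) * ln 2 / ln y \<le> real (card (primes_upto y))"
        using chebyshev_lower[of y] y lt by (simp add: field_simps)
      moreover have "(y - 2) * ln 2 / ln y \<ge> 66 / 100 * (y / ln y)"
      proof -
        have "(y - 2) * ln 2 \<ge> (y - 2) * (2 / 3)"
          using y ln_bounds by (intro mult_left_mono) auto
        moreover have "(y - 2) * (2 / 3) \<ge> 66 / 100 * y" using y by simp
        ultimately have "(y - 2) * ln 2 \<ge> 66 / 100 * y" by (rule order_trans[rotated])
        then show ?thesis using lt by (simp add: field_simps)
      qed
      ultimately show "2 / 5 * (y / ln y) \<le> real (card (primes_upto y)) - real m + 1"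
        using m by linarith
    qed
  qed
qed

text \<open>For y beyond some Z the bounded m is negligible against y / ln y. For y below Z the
  quotient y / ln y is at most Z, while the left side is at least 1: there are at least m primes,
  and 1 is added.\<close>

lemma card_primes_upto_ge_uniform:
  "\<exists>c>0. \<forall>m<M0. m \<ge> 2 \<longrightarrow> (\<forall>y \<ge> 4 * real m * ln (real m).
     real (card (primes_upto y)) - real m + 1 \<ge> c * (y / ln y))"
proof -
  have "eventually (\<lambda>y::real. 2/3 * ((y - 2) / ln y) - real M0 \<ge> 1 / 2 * (y / ln y)) at_top"
    by real_asymp
  then obtain Y where Y: "\<And>y. y \<ge> Y \<Longrightarrow> 2/3 * ((y - 2) / ln y) - real M0 \<ge> 1 / 2 * (y / ln y)"
    by (auto simp: eventually_at_top_linorder)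
  define Z where "Z = max Y 1"
  define c where "c = min (1/2) (1 / Z)"
  have c: "c > 0" "c \<le> 1/2" "c \<le> 1 / Z" by (auto simp: c_def Z_def)
  have "real (card (primes_upto y)) - real m + 1 \<ge> c * (y / ln y)"
    if m: "m < M0" "m \<ge> 2" and y: "y \<ge> 4 * real m * ln (real m)" for m y
  proof -
    have y4: "y \<ge> 5" using y four_m_ln_m_gt_5[OF m(2)] by simp
    have ly: "ln y > 1" using y4 exp_le ln_less_cancel_iff[of "exp 1" y] by simp
    have 1: "real (card (primes_upto y)) \<ge> real m"
      using card_primes_upto_ge[OF m(2) y] by simp
    show ?thesis
    proof (cases "y \<ge> Z")
      case True
      have "(y - 2) * (2 / 3) \<le> (y - 2) * ln 2"
        using y4 ln_bounds by (intro mult_left_mono) auto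
      also have "\<dots> \<le> real (card (primes_upto y)) * ln y"
        using y4 by (intro chebyshev_lower) auto
      finally have "2/3 * ((y - 2) / ln y) \<le> real (card (primes_upto y))"
        using ly by (simp add: field_simps)
      moreover have "2/3 * ((y - 2) / ln y) - real M0 \<ge> 1 / 2 * (y / ln y)"
        using True by (intro Y) (simp add: Z_def)
      moreover have "1 / 2 * (y / ln y) \<ge> c * (y / ln y)"
        using c ly y4 by (intro mult_right_mono) auto
      ultimately show ?thesis using m by linarith
    next
      case False
      have "c * (y / ln y) \<le> 1 / Z * Z"
      proof (intro mult_mono)
        have "y / ln y \<le> y / 1" using ly y4 by (intro divide_left_mono) auto
        then show "y / ln y \<le> Z" using False by simp
      qed (use c ly y4 in \<open>auto simp: Z_def\<close>)
      then show ?thesis using 1 by (simp add: Z_def split: if_splits)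
    qed
  qed
  then show ?thesis using c by blast
qed

lemma const_over_positive_sequence_bounded_below:
  fixes f :: "nat \<Rightarrow> real"
  assumes "\<And>n. f n > 0" "eventually (\<lambda>n. f n \<ge> 1) sequentially"
  shows "\<exists>B>0. \<forall>n. f n \<ge> B"
proof -
  obtain N where N: "\<And>n. n \<ge> N \<Longrightarrow> f n \<ge> 1"
    using assms(2) by (auto simp: eventually_sequentially)
  define B where "B = Min (insert 1 (f ` {..<N}))"
  have "B > 0" using assms(1) by (simp add: B_def)
  moreover have "f n \<ge> B" for n
  proof (cases "n < N")
    case False
    then have "B \<le> 1" "f n \<ge> 1" using N by (simp_all add: B_def)
    then show ?thesis by linarith
  qed (simp add: B_def)
  ultimately show ?thesis by blast
qed

text \<open>The constant \<open>2/5\<close> reached for large \<open>m\<close> exceeds \<open>1/e\<close>, so that the powers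
  \<open>(c e)\<^sup>A\<close> absorb the polynomial factor \<open>(e A)\<^sup>2\<close> lost in bounding \<open>A!\<close>.\<close>

lemma prime_surplus:
  "\<exists>B>0. \<forall>A\<ge>1. \<exists>c>0. B \<le> (c * exp 1) ^ A / (exp 1 * real A) ^ 2 \<and>
     (\<forall>m \<ge> max 2 A. \<forall>y \<ge> 4 * real m * ln (real m).
        c * (y / ln y) \<le> real (card (primes_upto y)) - real m + 1)"
proof -
  obtain M0 where M0: "\<And>m y. m \<ge> M0 \<Longrightarrow> y \<ge> 4 * real m * ln (real m) \<Longrightarrow>
      2 / 5 * (y / ln y) \<le> real (card (primes_upto y)) - real m + 1"
    using eventually_card_primes_upto_ge by (auto simp: eventually_sequentially)
  obtain c where c: "c > 0" "\<And>m y. m < M0 \<Longrightarrow> m \<ge> 2 \<Longrightarrow> y \<ge> 4 * real m * ln (real m) \<Longrightarrow>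
      c * (y / ln y) \<le> real (card (primes_upto y)) - real m + 1"
    using card_primes_upto_ge_uniform[of M0] by blast
  \<comment> \<open>Since m >= A, a value m < \<open>M0\<close> can occur only for A <
    \<open>M0\<close>. Hence the weaker constant c affects only finitely many A, and 2/5 is
    available for all others.\<close>
  define g where "g A = (if A < M0 then min c (2/5) else 2/5)" for A :: nat
  \<comment> \<open>The default 1 keeps \<open>f\<close> positive at A = 0, where the quotient would
    be 0.\<close>
  define f where "f A = (if A = 0 then 1 else (g A * exp 1) ^ A / (exp 1 * real A) ^ 2)" for A
  have gpos: "g A > 0" for A using c by (simp add: g_def)
  have fpos: "f A > 0" for A using gpos by (simp add: f_def)
  have ev: "eventually (\<lambda>A. f A \<ge> 1) sequentially"
  proof -
    \<comment> \<open>The base 1.05 is below 2/5 * 2.64, and e >= (13/8)^2 > 2.64.\<close>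
    have "eventually (\<lambda>A::nat. (1.05::real) ^ A / (exp 1 * real A) ^ 2 \<ge> 1) sequentially"
      by real_asymp
    moreover have "eventually (\<lambda>A. A \<ge> M0 \<and> A \<ge> 1) sequentially"
      by (intro eventually_conj eventually_ge_at_top)
    ultimately show ?thesis
    proof eventually_elim
      case (elim A)
      have "exp (1::real) = exp (1 / 2) ^ 2" using exp_double[of "1 / 2 :: real"] by simp
      moreover have "exp (1 / 2) \<ge> (13 / 8 :: real)"
        using exp_lower_Taylor_quadratic[of "1 / 2"] by (simp add: power2_eq_square)
      then have "exp (1 / 2) ^ 2 \<ge> (13 / 8 :: real) ^ 2" by (intro power_mono) auto
      ultimately have "exp 1 \<ge> (2.64 :: real)" by (simp add: power2_eq_square)
      then have "(1.05::real) ^ A \<le> (g A * exp 1) ^ A"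
        using elim by (intro power_mono) (simp_all add: g_def)
      then have "(1.05::real) ^ A / (exp 1 * real A) ^ 2 \<le> (g A * exp 1) ^ A / (exp 1 * real A) ^ 2"
        by (intro divide_right_mono) auto
      then have "1 \<le> (g A * exp 1) ^ A / (exp 1 * real A) ^ 2" using elim(1) by linarith
      then show ?case using elim(2) by (simp only: f_def split: if_splits) simp
    qed
  qed
  obtain B where B: "B > 0" "\<And>n. f n \<ge> B"
    using const_over_positive_sequence_bounded_below[OF fpos ev] by blast
  have surplus: "g A * (y / ln y) \<le> real (card (primes_upto y)) - real m + 1"
    if "m \<ge> max 2 A" "y \<ge> 4 * real m * ln (real m)" for A m y
  proof -
    have y: "y / ln y \<ge> 0" using that four_m_ln_m_gt_5[of m] by simp
    show ?thesis
    proof (cases "m < M0")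
      case True
      then have "A < M0" using that by simp
      then have "g A \<le> c" using that by (simp add: g_def)
      then have "g A * (y / ln y) \<le> c * (y / ln y)" using y by (rule mult_right_mono)
      then show ?thesis using c(2)[OF True _ that(2)] that(1) by simp
    next
      case False
      have "g A \<le> 2 / 5" by (cases "A < M0") (simp_all add: g_def)
      then have "g A * (y / ln y) \<le> 2 / 5 * (y / ln y)" using y by (rule mult_right_mono)
      then show ?thesis using M0[of m y] False that by simp
    qed
  qed
  show ?thesis
  proof (rule exI[of _ B], intro conjI allI impI)
    fix A :: nat assume "A \<ge> 1"
    then have "B \<le> (g A * exp 1) ^ A / (exp 1 * real A) ^ 2"
      using B(2)[of A] by (simp add: f_def)
    then show "\<exists>c>0. B \<le> (c * exp 1) ^ A / (exp 1 * real A) ^ 2 \<and>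
     (\<forall>m \<ge> max 2 A. \<forall>y \<ge> 4 * real m * ln (real m).
        c * (y / ln y) \<le> real (card (primes_upto y)) - real m + 1)"
      using gpos[of A] surplus[of A] by blast
  qed (rule B)
qed

section \<open>Splitting products of primes\<close>

text \<open>From n to n + 1 the left side gains the factor (n + 1) (1 + 1/n)^n / e, which is at most
  n + 1 because 1 + 1/n <= exp(1/n).\<close>

lemma fact_lower_bound:
  "(real n / exp 1) ^ n \<le> fact n"
proof (induction n)
  case (Suc n)
  have *: "(real (Suc n)) ^ n \<le> real n ^ n * exp 1"
  proof (cases "n = 0")
    case False
    have "(1 + 1 / real n) ^ n \<le> exp (1 / real n) ^ n"
      by (intro power_mono exp_ge_add_one_self) auto
    also have "\<dots> = exp 1" using False by (simp flip: exp_of_nat_mult)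
    finally have "real n ^ n * (1 + 1 / real n) ^ n \<le> real n ^ n * exp 1"
      by (intro mult_left_mono) auto
    moreover have "real n * (1 + 1 / real n) = real (Suc n)" using False by (simp add: field_simps)
    ultimately show ?thesis by (simp only: power_mult_distrib[symmetric])
  qed simp
  have "(real (Suc n) / exp 1) ^ Suc n = real (Suc n) * (real (Suc n) ^ n / exp 1 ^ Suc n)"
    by (simp add: power_divide)
  also have "\<dots> \<le> real (Suc n) * (real n ^ n * exp 1 / exp 1 ^ Suc n)"
    using * by (intro mult_left_mono divide_right_mono) auto
  also have "\<dots> = real (Suc n) * (real n / exp 1) ^ n" by (simp add: power_divide)
  also have "\<dots> \<le> real (Suc n) * fact n" using Suc by (intro mult_left_mono) auto
  finally show ?case by simp
qed simp

text \<open>From n to n + 1 the right side gains the factor (n + 1) (1 + 1/n)^(n+1) / e, which is at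
  least n + 1 because 1 - 1/(n+1) <= exp(-1/(n+1)).\<close>

lemma fact_upper_bound:
  "n \<ge> 1 \<Longrightarrow> fact n \<le> exp 1 * real n * (real n / exp 1) ^ n"
proof (induction n rule: nat_induct_at_least)
  case (Suc n)
  have "(1 - 1 / real (Suc n)) ^ Suc n \<le> exp (- (1 / real (Suc n))) ^ Suc n"
    using exp_ge_add_one_self[of "- (1 / real (Suc n))"] by (intro power_mono) auto
  also have "\<dots> = exp (- 1)"
    by (subst exp_of_nat_mult[symmetric]) simp
  also have "1 - 1 / real (Suc n) = real n / real (Suc n)" by (simp add: field_simps)
  finally have *: "real n ^ Suc n * exp 1 \<le> real (Suc n) ^ Suc n"
    by (simp add: power_divide exp_minus field_simps del: power_Suc of_nat_Suc)
  have "fact (Suc n) = real (Suc n) * fact n" by simp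
  also have "\<dots> \<le> real (Suc n) * (exp 1 * real n * (real n / exp 1) ^ n)"
    using Suc by (intro mult_left_mono) auto
  also have "\<dots> = real (Suc n) * exp 1 * (real n ^ Suc n * exp 1 / exp 1 ^ Suc n)"
    by (simp add: power_divide)
  also have "\<dots> \<le> real (Suc n) * exp 1 * (real (Suc n) ^ Suc n / exp 1 ^ Suc n)"
    using * by (intro mult_left_mono divide_right_mono) auto
  finally show ?case by (simp add: power_divide mult_ac)
qed simp

text \<open>Each of the factors r + 1, ..., r + n is at least r + 1. This bounds binomial
  coefficients from below.\<close>

lemma power_mult_fact_le: "Suc r ^ n * fact r \<le> (fact (r + n) :: nat)"
proof (induction n)
  case (Suc n)
  have "Suc r ^ Suc n * fact r = Suc r * (Suc r ^ n * fact r)"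
    by (simp only: power_Suc mult.assoc)
  also have "\<dots> \<le> Suc (r + n) * fact (r + n)" using Suc by (intro mult_mono) auto
  finally show ?case by simp
qed simp

section \<open>Factorizations into blocks of primes\<close>

definition factor_lists :: "nat \<Rightarrow> nat \<Rightarrow> real \<Rightarrow> nat list set" where
  "factor_lists k N x =
     {ms. length ms = k \<and> prod_list ms = N \<and> (\<forall>m\<in>set ms. 0 < m \<and> real m \<le> x)}"

lemma d_trunc_eq: "d_trunc k N x = card (factor_lists k N x)"
  by (simp add: d_trunc_def factor_lists_def)

lemma dvd_prod_list: "m \<in> set ms \<Longrightarrow> (m :: 'a :: comm_semiring_1) dvd prod_list ms"
  by (induction ms) auto

lemma finite_factor_lists: "finite (factor_lists k N x)"
proof (rule finite_subset)
  show "factor_lists k N x \<subseteq> {ms. set ms \<subseteq> {..nat \<lfloor>x\<rfloor>} \<and> length ms = k}"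
    by (auto simp: factor_lists_def le_nat_floor)
qed (intro finite_lists_length_eq, simp)

text \<open>The set is recovered from its product as the set of prime divisors.\<close>

lemma inj_on_prod_primes:
  "inj_on (\<lambda>U. \<Prod>U) {U. finite U \<and> (\<forall>p\<in>U. prime (p::nat))}"
proof (rule inj_on_inverseI)
  fix U :: "nat set" assume U: "U \<in> {U. finite U \<and> (\<forall>p\<in>U. prime p)}"
  then show "{p. prime p \<and> p dvd \<Prod>U} = U"
    by (auto simp: prime_dvd_prod_iff) (metis primes_dvd_imp_eq)
qed

lemma prod_primes_le:
  assumes "finite U" "\<And>p. p \<in> U \<Longrightarrow> real p \<le> y" "card U = A"
  shows "real (\<Prod>U) \<le> y ^ A"
  using prod_mono[of U real "\<lambda>_. y"] assms by simp

text \<open>The primes in T are distributed into k ordered blocks of size A, each with product at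
  most y^A. In the induction, the first block U can be chosen in (A (k + 1) choose A) ways and T - U
  is distributed recursively; the head of the resulting list determines U by unique
  factorization.\<close>

lemma fact_le_d_trunc_prod_primes:
  assumes "finite T" "\<And>p. p \<in> T \<Longrightarrow> prime p \<and> real p \<le> y" "card T = A * k"
  shows "fact (A * k) \<le> d_trunc k (\<Prod>T) (y ^ A) * fact A ^ k"
  using assms
proof (induction k arbitrary: T)
  case 0
  then have "factor_lists 0 (\<Prod>T) (y ^ A) = {[]}" by (auto simp: factor_lists_def)
  then show ?case by (simp add: d_trunc_eq)
next
  case (Suc k)
  define \<U> where "\<U> = {U. U \<subseteq> T \<and> card U = A}"
  have fU: "finite \<U>" using Suc.prems(1) by (auto simp: \<U>_def)
  have U: "finite U" "U \<subseteq> T" "card U = A" "card (T - U) = A * k" if "U \<in> \<U>" for U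
    using that Suc.prems(1,3) by (auto simp: \<U>_def card_Diff_subset finite_subset)
  let ?S = "SIGMA U:\<U>. factor_lists k (\<Prod>(T - U)) (y ^ A)"
  have "card ?S \<le> card (factor_lists (Suc k) (\<Prod>T) (y ^ A))"
  proof (rule card_inj_on_le[of "\<lambda>(U, ms). \<Prod>U # ms"])
    show "inj_on (\<lambda>(U, ms). \<Prod>U # ms) ?S"
    proof (rule inj_onI, clarsimp)
      fix U ms V assume UV: "U \<in> \<U>" "V \<in> \<U>" "\<Prod>U = \<Prod>V"
      then show "U = V"
        using U(1,2)[OF UV(1)] U(1,2)[OF UV(2)] Suc.prems(2)
        by (intro inj_onD[OF inj_on_prod_primes]) blast+
    qed
    show "(\<lambda>(U, ms). \<Prod>U # ms) ` ?S \<subseteq> factor_lists (Suc k) (\<Prod>T) (y ^ A)"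
    proof clarify
      fix U ms assume UV: "U \<in> \<U>" and ms: "ms \<in> factor_lists k (\<Prod>(T - U)) (y ^ A)"
      have "\<Prod>U * \<Prod>(T - U) = \<Prod>T"
        using prod.subset_diff[OF U(2)[OF UV] Suc.prems(1), of "\<lambda>p. p"] by (simp add: mult.commute)
      moreover have "real (\<Prod>U) \<le> y ^ A"
        using U[OF UV] Suc.prems(2) by (intro prod_primes_le) auto
      moreover have "\<Prod>U > 0"
        using U[OF UV] Suc.prems(2) by (intro prod_pos) (auto simp: prime_gt_0_nat)
      ultimately show "\<Prod>U # ms \<in> factor_lists (Suc k) (\<Prod>T) (y ^ A)"
        using ms by (auto simp: factor_lists_def)
    qed
  qed (rule finite_factor_lists)
  also have "card ?S = (\<Sum>U\<in>\<U>. card (factor_lists k (\<Prod>(T - U)) (y ^ A)))"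
    using fU finite_factor_lists by (simp add: card_SigmaI)
  finally have *: "(\<Sum>U\<in>\<U>. d_trunc k (\<Prod>(T - U)) (y ^ A)) \<le> d_trunc (Suc k) (\<Prod>T) (y ^ A)"
    by (simp add: d_trunc_eq)
  have "card \<U> = (A * Suc k) choose A"
    unfolding \<U>_def using Suc.prems(1,3) by (simp add: n_subsets)
  then have "fact (A * Suc k) = fact A * (card \<U> * fact (A * k))"
    using binomial_fact_lemma[of A "A * Suc k"] by (simp add: mult_ac)
  also have "card \<U> * fact (A * k) = (\<Sum>U\<in>\<U>. fact (A * k))" by simp
  also have "\<dots> \<le> (\<Sum>U\<in>\<U>. d_trunc k (\<Prod>(T - U)) (y ^ A) * fact A ^ k)"
    using U Suc.prems(1,2) by (intro sum_mono Suc.IH) auto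
  also have "\<dots> \<le> d_trunc (Suc k) (\<Prod>T) (y ^ A) * fact A ^ k"
    using * by (simp flip: sum_distrib_right)
  finally show ?case by (simp add: mult_ac)
qed

lemma finite_flat_nats [simp]: "finite (flat_nats q y)"
proof (rule finite_subset)
  show "flat_nats q y \<subseteq> {..nat \<lfloor>y\<rfloor>}" by (auto simp: flat_nats_def le_nat_floor)
qed simp

lemma prod_primes_in_flat_nats:
  assumes "finite T" "\<And>p. p \<in> T \<Longrightarrow> prime p \<and> real p \<le> y \<and> \<not> p dvd q" "card T = n"
  shows "\<Prod>T \<in> flat_nats q (y ^ n)"
proof -
  have "squarefree (\<Prod>T)"
    using assms by (intro squarefree_prod_coprime) (auto simp: primes_coprime squarefree_prime)
  moreover have "coprime (\<Prod>T) q"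
    using assms by (intro prod_coprime_left) (auto intro: prime_imp_coprime)
  moreover have "\<Prod>T > 0" using assms by (intro prod_pos) (auto simp: prime_gt_0_nat)
  ultimately show ?thesis
    using assms prod_primes_le[of T y n] by (auto simp: flat_nats_def)
qed

text \<open>The subsets T of P of size A k have distinct products N. Their number is at least (r +
  1)^(A k) / (A k)!, and each contributes at least ((A k)! / A!^k)^2.\<close>

lemma sum_d_trunc_sq_ge:
  assumes "finite P" "\<And>p. p \<in> P \<Longrightarrow> prime p \<and> real p \<le> y \<and> \<not> p dvd q" "card P = r + A * k"
  shows "real (Suc r) ^ (A * k) * fact (A * k) \<le>
    (\<Sum>N\<in>flat_nats q ((y ^ A) ^ k). real (d_trunc k N (y ^ A)) ^ 2) * (fact A ^ k) ^ 2"
proof -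
  define \<T> where "\<T> = {T. T \<subseteq> P \<and> card T = A * k}"
  have T: "finite T" "\<And>p. p \<in> T \<Longrightarrow> prime p \<and> real p \<le> y \<and> \<not> p dvd q" "card T = A * k"
    if "T \<in> \<T>" for T
    using that assms(1,2) by (auto simp: \<T>_def intro: finite_subset)
  have "Suc r ^ (A * k) * fact r \<le> (fact (card P) :: nat)"
    using power_mult_fact_le[of r "A * k"] assms(3) by simp
  also have "fact (card P) = fact (A * k) * card \<T> * (fact r :: nat)"
    using binomial_fact_lemma[of "A * k" "card P"] assms(1,3)
    by (simp add: \<T>_def n_subsets mult_ac)
  finally have "Suc r ^ (A * k) \<le> fact (A * k) * card \<T>" by simp
  then have "real (Suc r ^ (A * k)) \<le> real (fact (A * k) * card \<T>)" by (simp only: of_nat_le_iff)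
  then have "real (Suc r) ^ (A * k) * fact (A * k) \<le> (fact (A * k) * real (card \<T>)) * fact (A * k)"
    by (intro mult_right_mono) (simp_all add: of_nat_fact)
  also have "\<dots> = (\<Sum>T\<in>\<T>. fact (A * k) ^ 2)" by (simp add: power2_eq_square)
  also have "\<dots> \<le> (\<Sum>T\<in>\<T>. (real (d_trunc k (\<Prod>T) (y ^ A)) * fact A ^ k) ^ 2)"
  proof (intro sum_mono power_mono)
    fix T assume "T \<in> \<T>"
    then have "fact (A * k) \<le> d_trunc k (\<Prod>T) (y ^ A) * fact A ^ k"
      using T by (intro fact_le_d_trunc_prod_primes) blast+
    then have "real (fact (A * k)) \<le> real (d_trunc k (\<Prod>T) (y ^ A) * fact A ^ k)"
      by (simp only: of_nat_le_iff)
    then show "fact (A * k) \<le> real (d_trunc k (\<Prod>T) (y ^ A)) * fact A ^ k"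
      by (simp add: of_nat_fact)
  qed simp
  also have "\<dots> = (\<Sum>T\<in>\<T>. real (d_trunc k (\<Prod>T) (y ^ A)) ^ 2) * (fact A ^ k) ^ 2"
    by (simp add: power_mult_distrib sum_distrib_right)
  also have "(\<Sum>T\<in>\<T>. real (d_trunc k (\<Prod>T) (y ^ A)) ^ 2) =
      (\<Sum>N\<in>(\<lambda>T. \<Prod>T) ` \<T>. real (d_trunc k N (y ^ A)) ^ 2)"
    using T by (subst sum.reindex) (auto intro!: inj_on_subset[OF inj_on_prod_primes])
  also have "\<dots> \<le> (\<Sum>N\<in>flat_nats q ((y ^ A) ^ k). real (d_trunc k N (y ^ A)) ^ 2)"
    using T by (intro sum_mono2) (auto simp: power_mult[symmetric] intro!: prod_primes_in_flat_nats)
  finally show ?thesis by (simp add: mult_right_mono)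
qed

section \<open>The second inequality\<close>

text \<open>The prime surplus and the factorial estimates bound the sum below by the k-th power of x
  (k / ln x)^A times a factor depending only on A, which is at least B. The implied constant is
  \<open>sqrt B\<close>.\<close>

lemma sum_d_trunc_sq_lower_bound:
  "\<exists>C::real. C > 0 \<and>
     (\<forall>(q::nat) (k::nat) (A::nat) (K::nat) (x::real).
        q \<ge> 1 \<longrightarrow> k \<ge> 1 \<longrightarrow> A \<ge> 1 \<longrightarrow> K = max k (omega q) \<longrightarrow>
        x \<ge> (4 * real (A * k + K) * ln (real (A * k + K))) ^ A \<longrightarrow>
        (\<Sum>N\<in>flat_nats q (x ^ k). real (d_trunc k N x) ^ 2) powr (1 / (2 * real k))
          \<ge> C * x powr (1 / 2) * (real k / ln x) powr (real A / 2))"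
proof -
  obtain B where B: "B > 0" "\<And>A. A \<ge> 1 \<Longrightarrow> \<exists>c>0. B \<le> (c * exp 1) ^ A / (exp 1 * real A) ^ 2 \<and>
     (\<forall>m \<ge> max 2 A. \<forall>y \<ge> 4 * real m * ln (real m).
        c * (y / ln y) \<le> real (card (primes_upto y)) - real m + 1)"
    using prime_surplus by blast
  have "(\<Sum>N\<in>flat_nats q (x ^ k). real (d_trunc k N x) ^ 2) powr (1 / (2 * real k))
          \<ge> sqrt B * x powr (1 / 2) * (real k / ln x) powr (real A / 2)"
    if q: "q \<ge> 1" and k: "k \<ge> 1" and A: "A \<ge> 1" and K: "K = max k (omega q)"
      and x: "x \<ge> (4 * real (A * k + K) * ln (real (A * k + K))) ^ A" for q k A K :: nat and x
  proof -
    define m where "m = A * k + K"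
    define n where "n = A * k"
    define S where "S = (\<Sum>N\<in>flat_nats q (x ^ k). real (d_trunc k N x) ^ 2)"
    obtain c where c: "c > 0" "B \<le> (c * exp 1) ^ A / (exp 1 * real A) ^ 2"
      "\<And>m y. m \<ge> max 2 A \<Longrightarrow> y \<ge> 4 * real m * ln (real m) \<Longrightarrow>
        c * (y / ln y) \<le> real (card (primes_upto y)) - real m + 1"
      using B(2)[OF A] by blast
    have "A \<le> n" "k \<le> n" "1 \<le> n" using k A by (simp_all add: n_def)
    moreover have mn: "m = n + K" by (simp add: m_def n_def)
    ultimately have m: "m \<ge> 2" "m \<ge> A" "m = n + K" using k K by linarith+
    define t where "t = 4 * real m * ln (real m)"
    then have t: "t > 5" using four_m_ln_m_gt_5[OF m(1)] by simp
    define y where "y = root A x"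
    have xt: "x \<ge> t ^ A" using x by (simp add: t_def m_def)
    have xpos: "x > 0" using xt t by (meson less_le_trans zero_less_power order.strict_trans zero_less_numeral)
    have yA: "y ^ A = x" using xpos A by (simp add: y_def)
    have yt: "y \<ge> t"
      using real_root_le_mono[of A "t ^ A" x] A t xt by (simp add: y_def real_root_power_cancel)
    have lny: "ln y > 0" using yt t by simp
    have lnx: "ln x = real A * ln y" using yA yt t by (metis ln_realpow less_trans less_le_trans zero_less_numeral)
    have lnx0: "ln x > 0" using lnx lny A by simp

    define P where "P = primes_upto y - prime_factors q"
    have "card (primes_upto y) - omega q \<le> card P"
      unfolding P_def omega_def by (rule diff_card_le_card_Diff) simp
    moreover have "m \<le> card (primes_upto y)"
      using m yt by (intro card_primes_upto_ge) (auto simp: t_def)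
    ultimately have cP: "n \<le> card P" "card (primes_upto y) \<le> card P + K"
      using m K by auto
    \<comment> \<open>At most K primes were removed and m = n + K, so r + 1 >= pi(y) - m + 1, the
      surplus bounded below by c.\<close>
    define r where "r = card P - n"
    have r: "c * (y / ln y) \<le> real (Suc r)"
    proof -
      have "c * (y / ln y) \<le> real (card (primes_upto y)) - real m + 1"
        using m yt by (intro c(3)) (auto simp: t_def)
      also have "\<dots> \<le> real (Suc r)" using cP m by (simp add: r_def of_nat_diff)
      finally show ?thesis .
    qed
    have main: "real (Suc r) ^ n * fact n \<le> S * (fact A ^ k) ^ 2"
      unfolding n_def S_def yA[symmetric]
    proof (rule sum_d_trunc_sq_ge[of P])
      show "finite P" by (simp add: P_def)
      show "card P = r + A * k" using cP(1) by (simp add: r_def n_def)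
      show "prime p \<and> real p \<le> y \<and> \<not> p dvd q" if "p \<in> P" for p
        using that q by (auto simp: P_def primes_upto_def in_prime_factors_iff)
    qed
    have S0: "S \<ge> 0" unfolding S_def by (intro sum_nonneg) auto
    define F where "F = exp 1 * real A * (real A / exp 1) ^ A"
    have F0: "F > 0" using A by (simp add: F_def)
    have "(c * (y / ln y)) ^ n * (real n / exp 1) ^ n \<le> real (Suc r) ^ n * fact n"
      using r c(1) lny yt t by (intro mult_mono power_mono fact_lower_bound) auto
    also note main
    also have "S * (fact A ^ k) ^ 2 \<le> S * (F ^ k) ^ 2"
      using S0 A unfolding F_def by (intro mult_left_mono power_mono fact_upper_bound) auto
    finally have "(c * (y / ln y)) ^ n * (real n / exp 1) ^ n / (F ^ k) ^ 2 \<le> S"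
      using F0 by (subst pos_divide_le_eq) simp_all
    also have "(c * (y / ln y)) ^ n * (real n / exp 1) ^ n / (F ^ k) ^ 2 =
        (((c * (y / ln y)) * (real n / exp 1)) ^ A / F ^ 2) ^ k"
    proof -
      have "U ^ n * V ^ n = ((U * V) ^ A) ^ k" for U V :: real
        by (simp only: n_def power_mult power_mult_distrib)
      moreover have "(F ^ k) ^ 2 = (F ^ 2) ^ k"
        by (simp add: mult.commute flip: power_mult)
      ultimately show ?thesis by (simp only: power_divide[of _ "F\<^sup>2"])
    qed
    also have "((c * (y / ln y)) * (real n / exp 1)) ^ A / F ^ 2 =
        (c * exp 1) ^ A / (exp 1 * real A) ^ 2 * (x * (real k / ln x) ^ A)"
    proof -
      \<comment> \<open>One factor A comes from ln x = A ln y and another from n = A k. Together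
        they form the square of (A/e)^A that cancels against \<open>F ^ 2\<close>, leaving only (e
        A)^2 below.\<close>
      have "y / ln y = real A * y / ln x" using A lny by (simp add: lnx)
      then have "(c * (y / ln y)) * (real n / exp 1) =
          (c * exp 1) * (y * (real k / ln x)) * (real A / exp 1) ^ 2"
        by (simp add: n_def power2_eq_square field_simps)
      then have "((c * (y / ln y)) * (real n / exp 1)) ^ A =
          (c * exp 1) ^ A * (x * (real k / ln x) ^ A) * ((real A / exp 1) ^ A) ^ 2"
        by (simp only: power_mult_distrib yA power_mult[symmetric] mult.commute[of 2])
      moreover have "F ^ 2 = (exp 1 * real A) ^ 2 * ((real A / exp 1) ^ A) ^ 2"
        by (simp only: F_def power_mult_distrib)
      moreover have "(real A / exp 1) ^ A \<noteq> 0" using A by simp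
      ultimately show ?thesis by simp
    qed
    finally have "((c * exp 1) ^ A / (exp 1 * real A) ^ 2 * (x * (real k / ln x) ^ A)) ^ k \<le> S" .
    moreover have "(B * (x * (real k / ln x) ^ A)) ^ k \<le>
        ((c * exp 1) ^ A / (exp 1 * real A) ^ 2 * (x * (real k / ln x) ^ A)) ^ k"
      using c B(1) xpos lnx0 by (intro power_mono mult_right_mono) auto
    ultimately have "(B * (x * (real k / ln x) ^ A)) ^ k \<le> S" by linarith
    then have "((B * (x * (real k / ln x) ^ A)) ^ k) powr (1 / (2 * real k)) \<le> S powr (1 / (2 * real k))"
      using B xpos lnx0 by (intro powr_mono2) auto
    \<comment> \<open>The exponents k and 1 / (2 k) combine to 1/2, so no dependence on k enters the
      constant.\<close>
    also have "((B * (x * (real k / ln x) ^ A)) ^ k) powr (1 / (2 * real k)) =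
        (B * (x * (real k / ln x) ^ A)) powr (1 / 2)"
      using k B xpos lnx0 by (subst powr_realpow[symmetric]) (auto simp: powr_powr)
    also have "\<dots> = sqrt B * x powr (1 / 2) * (real k / ln x) powr (real A / 2)"
    proof -
      have "((real k / ln x) ^ A) powr (1 / 2) = (real k / ln x) powr (real A / 2)"
        using k lnx0 by (subst powr_realpow[symmetric]) (simp_all add: powr_powr)
      then show ?thesis
        using B xpos lnx0 by (simp add: powr_mult flip: powr_half_sqrt)
    qed
    finally show ?thesis by (simp add: S_def)
  qed
  then show ?thesis using B(1) by (intro exI[of _ "sqrt B"]) auto
qed

section \<open>Orthogonality and moments\<close>

lemma integral_uniform_circle:
  fixes f :: "complex \<Rightarrow> complex"
  assumes [measurable]: "f \<in> borel_measurable borel"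
  shows "integral\<^sup>L uniform_circle f =
    (LINT t|lborel. indicator {0..2 * pi} t *\<^sub>R (f (cis t) / (2 * pi)))"
proof -
  have [measurable]: "cis \<in> borel_measurable borel"
    by (intro borel_measurable_continuous_onI continuous_intros)
  have "uniform_measure lborel {0..2 * pi} =
      density lborel (\<lambda>t. ennreal (indicator {0..2 * pi} t / (2 * pi)))"
    unfolding uniform_measure_def
    by (intro density_cong) (auto simp: indicator_def divide_ennreal simp flip: ennreal_1)
  then have "integral\<^sup>L uniform_circle f =
      integral\<^sup>L (density lborel (\<lambda>t. ennreal (indicator {0..2 * pi} t / (2 * pi)))) (\<lambda>t. f (cis t))"
    unfolding uniform_circle_def by (subst integral_distr) simp_all
  also have "\<dots> = (LINT t|lborel. indicator {0..2 * pi} t *\<^sub>R (f (cis t) / (2 * pi)))"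
    by (subst integral_density) (auto simp: scaleR_conv_of_real intro!: Bochner_Integration.integral_cong)
  finally show ?thesis .
qed

text \<open>For n \<noteq> 0 the integrand has an antiderivative of period 2 pi, because n is an
  integer.\<close>

lemma integral_cis_int_multiple:
  fixes n :: int
  shows "(LINT t|lborel. indicator {0..2 * pi} t *\<^sub>R (cis (n * t) / (2 * pi))) =
    (if n = 0 then 1 else 0)"
proof (cases "n = 0")
  case True
  have "(LINT t|lborel. indicator {0..2 * pi} t *\<^sub>R (1 / (2 * complex_of_real pi))) = 1"
    by (simp add: scaleR_conv_of_real)
  then show ?thesis using True by simp
next
  case False
  define F :: "real \<Rightarrow> complex" where "F t = cis (real_of_int n * t) / (2 * pi * \<i> * n)" for t
  have "(F has_vector_derivative cis (n * t) / (2 * pi)) (at t within {0..2 * pi})" for t :: real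
    unfolding F_def using False
    by (auto intro!: derivative_eq_intros simp: has_vector_derivative_def scaleR_conv_of_real field_simps)
  then have "(LINT t|lborel. indicator {0..2 * pi} t *\<^sub>R (cis (n * t) / (2 * pi))) = F (2 * pi) - F 0"
    by (intro integral_FTC_atLeastAtMost) (auto intro!: continuous_intros)
  also have "cis (n * (2 * pi)) = 1"
    using cis_multiple_2pi[of "real_of_int n"] by (simp add: mult_ac)
  then have "F (2 * pi) - F 0 = 0" by (simp add: F_def)
  finally show ?thesis using False by simp
qed

lemma AE_uniform_circle: "AE z in uniform_circle. cmod z = 1"
proof -
  have [measurable]: "cis \<in> borel_measurable borel"
    by (intro borel_measurable_continuous_onI continuous_intros)
  show ?thesis unfolding uniform_circle_def by (subst AE_distr_iff) simp_all
qed

lemma borel_measurable_power_mult_cnj_power: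
  "(\<lambda>z :: complex. z ^ a * cnj z ^ b) \<in> borel_measurable borel"
  by (intro borel_measurable_continuous_onI continuous_intros)

text \<open>On the circle the integrand is e^(i (a - b) t). These moments suffice, as X_m times the
  conjugate of X_n splits into such factors over the primes.\<close>

lemma moment_uniform_circle:
  "(LINT z|uniform_circle. z ^ a * cnj z ^ b) = (if a = b then 1 else 0)"
proof -
  have "(LINT z|uniform_circle. z ^ a * cnj z ^ b) =
      (LINT t|lborel. indicator {0..2 * pi} t *\<^sub>R (cis t ^ a * cnj (cis t) ^ b / (2 * pi)))"
    by (rule integral_uniform_circle[OF borel_measurable_power_mult_cnj_power])
  also have "(\<lambda>t. cis t ^ a * cnj (cis t) ^ b) = (\<lambda>t. cis (real_of_int (int a - int b) * t))"
  proof
    fix t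
    have "cis t ^ a * cnj (cis t) ^ b = cis (real a * t + real b * - t)"
      unfolding cis_cnj by (subst (1 2) Complex.DeMoivre) (rule cis_mult)
    also have "real a * t + real b * - t = real_of_int (int a - int b) * t"
      by (simp add: algebra_simps)
    finally show "cis t ^ a * cnj (cis t) ^ b = cis (real_of_int (int a - int b) * t)" .
  qed
  finally show ?thesis unfolding integral_cis_int_multiple by simp
qed

text \<open>Expanding the power by distributivity, with the last factor becoming the head of the
  list, turns a k-th power of the random sum into a sum over k-tuples.\<close>

lemma power_sum_eq_sum_lists:
  fixes f :: "'b \<Rightarrow> 'a :: comm_semiring_1"
  assumes "finite F"
  shows "sum f F ^ k = (\<Sum>ms\<in>{ms. set ms \<subseteq> F \<and> length ms = k}. prod_list (map f ms))"
proof (induction k)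
  case 0
  have "{ms. set ms \<subseteq> F \<and> length ms = 0} = {[]}" by auto
  then show ?case by simp
next
  case (Suc k)
  have inj: "inj_on (\<lambda>(xs, n). n # xs) ({xs. set xs \<subseteq> F \<and> length xs = k} \<times> F)"
    by (auto simp: inj_on_def)
  have "sum f F ^ Suc k =
      (\<Sum>ms\<in>{ms. set ms \<subseteq> F \<and> length ms = k}. \<Sum>n\<in>F. prod_list (map f ms) * f n)"
    by (simp only: power_Suc2 Suc.IH sum_product)
  also have "\<dots> = (\<Sum>(ms, n)\<in>{xs. set xs \<subseteq> F \<and> length xs = k} \<times> F. prod_list (map f ms) * f n)"
    by (rule sum.cartesian_product)
  also have "\<dots> = (\<Sum>ms\<in>{ms. set ms \<subseteq> F \<and> length ms = Suc k}. prod_list (map f ms))"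
    unfolding lists_length_Suc_eq
    by (subst sum.reindex[OF inj]) (simp add: case_prod_beta mult.commute)
  finally show ?case .
qed

section \<open>Orthonormality and the first inequality\<close>

context random_comp_mult
begin

text \<open>In terms of multisets, complete multiplicativity follows from the additivity of prime
  factorizations.\<close>

lemma X_eq_prod_mset:
  assumes "n > 0" "w \<in> space M"
  shows "X n w = prod_mset (image_mset (\<lambda>p. X p w) (prime_factorization n))"
  unfolding image_prod_mset_multiplicity mult[OF assms]
  by (intro prod.cong) (simp_all add: count_prime_factorization_prime in_prime_factors_imp_prime)

lemma X_prod_list:
  assumes "w \<in> space M" "\<forall>m\<in>set ms. m > 0"
  shows "X (prod_list ms) w = prod_list (map (\<lambda>m. X m w) ms)"
  using assms(2)
proof (induction ms)
  case Nil
  show ?case using X_eq_prod_mset[of 1 w] assms(1) by simp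
next
  case (Cons m ms)
  then have "prod_list ms > 0" "m > 0" by (auto simp: prod_list_zero_iff intro!: Nat.gr0I)
  then show ?case
    using Cons assms(1) X_eq_prod_mset[of "m * prod_list ms" w]
      X_eq_prod_mset[of "prod_list ms" w] X_eq_prod_mset[of m w]
    by (simp add: prime_factorization_mult)
qed

lemma random_variable_prime: "prime p \<Longrightarrow> X p \<in> borel_measurable M"
  using indep by (auto simp: indep_vars_def)

text \<open>Only the distribution of \<open>X p\<close> is prescribed, so modulus 1 holds almost
  surely rather than everywhere. It supplies the bound for integrability.\<close>

lemma AE_cmod_prime: 
  assumes "prime p"
  shows "AE w in M. cmod (X p w) = 1"
  using AE_uniform_circle unfolding uniform[OF assms, symmetric]
  by (rule AE_distrD[OF random_variable_prime[OF assms]])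

text \<open>By independence the expectation factors over the primes dividing m or n. The factor at p
  is 1 if p has the same exponent in m and n, and 0 otherwise; if m \<noteq> n, some exponents
  differ.\<close>

lemma
  assumes "m > 0" "n > 0"
  shows integrable_X_mult_cnj: "integrable M (\<lambda>w. X m w * cnj (X n w))"
    and expectation_X_mult_cnj: "(LINT w|M. X m w * cnj (X n w)) = (if m = n then 1 else 0)"
proof -
  \<comment> \<open>A common index set lets both products run over the same primes, with exponent 0
    where a prime does not divide.\<close>
  define I where "I = prime_factors m \<union> prime_factors n"
  define Y where "Y p w = X p w ^ multiplicity p m * cnj (X p w) ^ multiplicity p n" for p w
  have I: "finite I" "\<And>p. p \<in> I \<Longrightarrow> prime p" by (auto simp: I_def)
  have X: "X l w = (\<Prod>p\<in>I. X p w ^ multiplicity p l)"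
    if "l > 0" "prime_factors l \<subseteq> I" "w \<in> space M" for l w
    unfolding mult[OF that(1,3)] using that I
    by (intro prod.mono_neutral_left) (auto simp: prime_factors_multiplicity)
  have XY: "X m w * cnj (X n w) = (\<Prod>p\<in>I. Y p w)" if "w \<in> space M" for w
    using that X[of m w] X[of n w] assms by (simp add: I_def Y_def prod.distrib)
  have "indep_vars (\<lambda>_. borel) X I"
    using indep by (rule indep_vars_subset) (use I in auto)
  then have indY: "indep_vars (\<lambda>_. borel) Y I"
    unfolding Y_def
    by (rule indep_vars_compose2) (rule borel_measurable_power_mult_cnj_power)
  have meas: "Y p \<in> borel_measurable M" if "p \<in> I" for p
    unfolding Y_def using random_variable_prime[OF I(2)[OF that]]
    by (rule measurable_compose[OF _ borel_measurable_power_mult_cnj_power])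
  have intY: "integrable M (Y p)" if "p \<in> I" for p
  proof (rule integrable_const_bound[of _ 1])
    show "AE w in M. norm (Y p w) \<le> 1"
      using AE_cmod_prime[OF I(2)[OF that]]
      by eventually_elim (simp add: Y_def norm_mult norm_power)
  qed (rule meas[OF that])
  have EY: "(LINT w|M. Y p w) = (if multiplicity p m = multiplicity p n then 1 else 0)"
    if "p \<in> I" for p
  proof -
    have "(LINT w|M. Y p w) =
        (LINT z|distr M borel (X p). z ^ multiplicity p m * cnj z ^ multiplicity p n)"
      unfolding Y_def using random_variable_prime[OF I(2)[OF that]]
      by (subst integral_distr) (simp_all add: borel_measurable_power_mult_cnj_power)
    then show ?thesis
      by (simp add: uniform[OF I(2)[OF that]] moment_uniform_circle)
  qed
  show "integrable M (\<lambda>w. X m w * cnj (X n w))"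
    using indep_vars_integrable[OF I(1) indY intY]
    by (subst Bochner_Integration.integrable_cong[OF refl XY])
  have "(LINT w|M. X m w * cnj (X n w)) = (\<Prod>p\<in>I. LINT w|M. Y p w)"
    using indep_vars_lebesgue_integral[OF I(1) indY intY]
    by (subst Bochner_Integration.integral_cong[OF refl XY])
  also have "\<dots> = (\<Prod>p\<in>I. if multiplicity p m = multiplicity p n then 1 else 0)"
    using EY by (intro prod.cong) auto
  also have "\<dots> = (if m = n then 1 else 0)"
  proof (cases "m = n")
    case False
    have "\<exists>p. prime p \<and> multiplicity p m \<noteq> multiplicity p n"
      using False multiplicity_eq_nat[of m n] assms by auto
    then obtain p where p: "prime p" "multiplicity p m \<noteq> multiplicity p n" by blast
    then have "p \<in> I" using assms by (auto simp: I_def prime_factors_multiplicity)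
    then show ?thesis using False p I(1) by auto
  qed simp
  finally show "(LINT w|M. X m w * cnj (X n w)) = (if m = n then 1 else 0)" .
qed

text \<open>Expanding the squared modulus and applying orthonormality leaves the pairs with equal
  index. The map \<open>g\<close> need not be injective: it will be the product of a tuple.\<close>

lemma second_moment_sum_X:
  assumes "finite J" "\<And>j. j \<in> J \<Longrightarrow> g j > 0"
  shows "(LINT w|M. cmod (\<Sum>j\<in>J. X (g j) w) ^ 2) = card {(i, j) \<in> J \<times> J. g i = g j}"
proof -
  have eq: "complex_of_real (cmod (\<Sum>j\<in>J. X (g j) w) ^ 2) =
      (\<Sum>i\<in>J. \<Sum>j\<in>J. X (g i) w * cnj (X (g j) w))" for w
    by (simp only: complex_norm_square cnj_sum sum_product)
  have "complex_of_real (LINT w|M. cmod (\<Sum>j\<in>J. X (g j) w) ^ 2) =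
      (LINT w|M. (\<Sum>i\<in>J. \<Sum>j\<in>J. X (g i) w * cnj (X (g j) w)))"
    by (simp only: integral_complex_of_real[symmetric] eq)
  also have "\<dots> = (\<Sum>i\<in>J. \<Sum>j\<in>J. (LINT w|M. X (g i) w * cnj (X (g j) w)))"
    using assms by (simp add: Bochner_Integration.integral_sum integrable_X_mult_cnj)
  also have "\<dots> = (\<Sum>(i, j)\<in>J \<times> J. if g i = g j then 1 else 0)"
    using assms by (simp add: expectation_X_mult_cnj sum.cartesian_product)
  also have "\<dots> = of_nat (card {(i, j) \<in> J \<times> J. g i = g j})"
    using assms(1)
    by (auto simp: sum.If_cases case_prod_beta intro!: arg_cong[of _ _ card])
  finally have "complex_of_real (LINT w|M. cmod (\<Sum>j\<in>J. X (g j) w) ^ 2) =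
      complex_of_real (card {(i, j) \<in> J \<times> J. g i = g j})"
    unfolding of_real_of_nat_eq .
  then show ?thesis by (rule of_real_eq_iff[THEN iffD1])
qed

text \<open>The moment counts the pairs of k-tuples from F with equal product. Keeping only the
  pairs whose product N is squarefree, coprime to q and at most y leaves d_k(N, x)^2 pairs for each
  such N.\<close>

lemma moment_ge_sum_d_trunc_sq:
  "(\<Sum>N\<in>flat_nats q y. real (d_trunc k N x) ^ 2) \<le>
    (LINT w|M. cmod (\<Sum>n\<in>flat_nats q x. X n w) ^ (2 * k))"
proof -
  define F where "F = flat_nats q x"
  define J where "J = {ms. set ms \<subseteq> F \<and> length ms = k}"
  have fJ: "finite J" unfolding J_def F_def by (intro finite_lists_length_eq) simp
  have pos: "\<forall>m\<in>set ms. m > 0" if "ms \<in> J" for ms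
    using that by (auto simp: J_def F_def flat_nats_def)
  then have pos': "prod_list ms > 0" if "ms \<in> J" for ms
    using that by (metis gr0I less_irrefl prod_list_zero_iff)
  \<comment> \<open>Divisors of N inherit squarefreeness and coprimality to q, so no factorization
    of N is lost by taking factors from F.\<close>
  have FL: "factor_lists k N x \<subseteq> J" if "N \<in> flat_nats q y" for N
  proof
    fix ms assume ms: "ms \<in> factor_lists k N x"
    have "m \<in> F" if "m \<in> set ms" for m
    proof -
      have "m dvd N" using ms dvd_prod_list[OF that] by (simp add: factor_lists_def)
      then show ?thesis
        using \<open>N \<in> flat_nats q y\<close> ms that
        by (auto simp: F_def flat_nats_def factor_lists_def intro: squarefree_mono coprime_divisors)
    qed
    then show "ms \<in> J" using ms by (auto simp: J_def factor_lists_def)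
  qed
  have "(\<Sum>N\<in>flat_nats q y. d_trunc k N x ^ 2) =
      card (SIGMA N:flat_nats q y. factor_lists k N x \<times> factor_lists k N x)"
    using finite_factor_lists
    by (simp add: card_SigmaI card_cartesian_product d_trunc_eq power2_eq_square)
  also have "\<dots> \<le> card {(i, j) \<in> J \<times> J. prod_list i = prod_list j}"
  \<comment> \<open>Forgetting N is injective, as N is the product of either tuple.\<close>
  proof (rule card_inj_on_le[of snd])
    show "finite {(i, j) \<in> J \<times> J. prod_list i = prod_list j}"
      by (rule finite_subset[of _ "J \<times> J"]) (use fJ in auto)
  qed (use FL in \<open>auto simp: inj_on_def factor_lists_def subset_iff\<close>)
  finally have "(\<Sum>N\<in>flat_nats q y. d_trunc k N x ^ 2) \<le>
      card {(i, j) \<in> J \<times> J. prod_list i = prod_list j}" .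
  then have "real (\<Sum>N\<in>flat_nats q y. d_trunc k N x ^ 2) \<le>
      real (card {(i, j) \<in> J \<times> J. prod_list i = prod_list j})" by (simp only: of_nat_le_iff)
  also have "\<dots> = (LINT w|M. cmod (\<Sum>ms\<in>J. X (prod_list ms) w) ^ 2)"
    using fJ pos' by (intro second_moment_sum_X[symmetric]) auto
  also have "\<dots> = (LINT w|M. cmod (\<Sum>n\<in>F. X n w) ^ (2 * k))"
  proof (intro Bochner_Integration.integral_cong refl)
    fix w assume "w \<in> space M"
    then have "(\<Sum>ms\<in>J. X (prod_list ms) w) = (\<Sum>n\<in>F. X n w) ^ k"
      unfolding power_sum_eq_sum_lists[OF finite_flat_nats[of q x, folded F_def]] J_def[symmetric]
      using X_prod_list pos by (intro sum.cong) auto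
    then show "cmod (\<Sum>ms\<in>J. X (prod_list ms) w) ^ 2 = cmod (\<Sum>n\<in>F. X n w) ^ (2 * k)"
      by (simp add: norm_power mult.commute flip: power_mult)
  qed
  finally show ?thesis by (simp add: F_def)
qed

end

theorem theorem4p2:
  "\<exists>C::real. C > 0 \<and>
     (\<forall>(q::nat) (k::nat) (A::nat) (K::nat) (x::real).
        q \<ge> 1 \<longrightarrow> k \<ge> 1 \<longrightarrow> A \<ge> 1 \<longrightarrow> K = max k (omega q) \<longrightarrow>
        x \<ge> (4 * real (A * k + K) * ln (real (A * k + K))) ^ A \<longrightarrow>
        (\<forall>(M :: 'a measure) X. random_comp_mult M X \<longrightarrow>
           (integral\<^sup>L M (\<lambda>w. cmod (\<Sum>n\<in>flat_nats q x. X n w) ^ (2 * k))) powr (1 / (2 * real k))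
             \<ge> (\<Sum>N\<in>flat_nats q (x ^ k). real (d_trunc k N x) ^ 2) powr (1 / (2 * real k))) \<and>
        (\<Sum>N\<in>flat_nats q (x ^ k). real (d_trunc k N x) ^ 2) powr (1 / (2 * real k))
          \<ge> C * x powr (1 / 2) * (real k / ln x) powr (real A / 2))"
proof -
  have "(\<Sum>N\<in>flat_nats q (x ^ k). real (d_trunc k N x) ^ 2) powr (1 / (2 * real k)) \<le>
      (integral\<^sup>L M (\<lambda>w. cmod (\<Sum>n\<in>flat_nats q x. X n w) ^ (2 * k))) powr (1 / (2 * real k))"
    if "random_comp_mult M X" for q k x and M :: "'a measure" and X
    by (intro powr_mono2 random_comp_mult.moment_ge_sum_d_trunc_sq[OF that] sum_nonneg) auto
  then show ?thesis using sum_d_trunc_sq_lower_bound by meson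
qed

end
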